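(* Let $\lambda$ be an ordinal number such that $\omega\leq\lambda<\aleph_1$ (that is, $\lambda$ is a countably infinite ordinal), and let $\mathcal{S}=\{\alpha_i\}_{i\in\lambda}$ be a sequence of ordinal numbers indexed by $\lambda$. Then the set $$T''(\mathcal{S})=\left\{\sum_{i\in\lambda}\alpha_{\varphi(i)}\ \middle|\ \varphi:\lambda\rightarrow\lambda\text{ is any map}\right\}$$ is at most countable.
   Context: An ordinal $\lambda$ is identified with the set of ordinals smaller than $\lambda$, and $\aleph_1$ is identified with the first uncountable ordinal $\omega_1$. For a sequence of ordinals $\{\beta_i\}_{i\in\lambda}$ (repetitions allowed), $\sum_{i\in\lambda}\beta_i$ denotes the usual transfinite ordinal sum, i.e. the order type of the concatenation of the $\beta_i$ in the order of their indices; equivalently, it is $s_\lambda$, where $s_0=0$, $s_{i+1}=s_i+\beta_i$, and $s_\delta=\sup_{i<\delta}s_i$ for limit $\delta\le\lambda$. The map $\varphi$ is an arbitrary function of sets. "At most countable" means finite or countably infinite. *)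

theory Defs
  imports Main "HOL-Library.Countable_Set" "HOL-Library.FuncSet"
begin

unbundle cardinal_syntax

text \<open>
  Ordinals are represented, as in the theory of well-orders in HOL, by relations \<open>r\<close> with
  \<open>Well_order r\<close>, two of which denote the same ordinal iff \<open>r =o s\<close>. An ordinal in the strict
  sense is an equivalence class of \<open>=o\<close>. The elements of \<open>Field r\<close> play the role of the ordinals
  smaller than \<open>r\<close>, so they index the sequences of length \<open>r\<close>. As well-orders on one type
  \<open>'b\<close> include isomorphic copies of any given set of ordinals for \<open>'b\<close> large enough, taking
  all terms of a sequence in the same type is no restriction.
\<close>

definition order_type :: "'c rel \<Rightarrow> 'c rel set"
  where "order_type s = {t. s =o t}"

text \<open>
  The transfinite sum is the concatenation of the orders \<open>\<beta> i\<close> along \<open>r\<close>: the disjoint union of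
  their fields, ordered first by the index and then, within one block, by \<open>\<beta> i\<close>.
  It depends on \<open>\<beta> i\<close> for \<open>i \<in> Field r\<close> only.
\<close>

definition ord_sum :: "'a rel \<Rightarrow> ('a \<Rightarrow> 'b rel) \<Rightarrow> ('a \<times> 'b) rel"
  where "ord_sum r \<beta> =
    {((i, x), (j, y)). (i, j) \<in> r \<and> i \<noteq> j \<and> x \<in> Field (\<beta> i) \<and> y \<in> Field (\<beta> j)} \<union>
    {((i, x), (j, y)). i = j \<and> i \<in> Field r \<and> (x, y) \<in> \<beta> i}"

definition sum_order_types :: "'a rel \<Rightarrow> ('a \<Rightarrow> 'b rel) \<Rightarrow> ('a \<times> 'b) rel set set"
  where "sum_order_types r \<alpha> =
    {order_type (ord_sum r (\<lambda>i. \<alpha> (\<phi> i))) | \<phi>. \<phi> \<in> Field r \<rightarrow> Field r}"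

lemma Field_ord_sum:
  assumes "Well_order r" and "\<And>i. i \<in> Field r \<Longrightarrow> Well_order (\<beta> i)"
  shows "Field (ord_sum r \<beta>) = (SIGMA i : Field r. Field (\<beta> i))"
proof
  show "Field (ord_sum r \<beta>) \<subseteq> (SIGMA i : Field r. Field (\<beta> i))"
    by (auto simp: ord_sum_def Field_def)
  have refl: "(x, x) \<in> \<beta> i" if "i \<in> Field r" "x \<in> Field (\<beta> i)" for i x
    using assms(2)[OF that(1)] that(2)
    by (auto simp: well_order_on_def linear_order_on_def partial_order_on_def preorder_on_def refl_on_def)
  then have "((i, x), (i, x)) \<in> ord_sum r \<beta>" if "i \<in> Field r" "x \<in> Field (\<beta> i)" for i x
    using that by (auto simp: ord_sum_def)
  then show "(SIGMA i : Field r. Field (\<beta> i)) \<subseteq> Field (ord_sum r \<beta>)"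
    by (auto intro: FieldI1)
qed

lemma Well_order_ord_sum:
  assumes r: "Well_order r" and \<beta>: "\<And>i. i \<in> Field r \<Longrightarrow> Well_order (\<beta> i)"
  shows "Well_order (ord_sum r \<beta>)"
proof -
  let ?S = "ord_sum r \<beta>"
  note defs = well_order_on_def linear_order_on_def partial_order_on_def preorder_on_def
  have R: "refl_on (Field r) r" "trans r" "antisym r" "total_on (Field r) r" "wf (r - Id)"
    using r by (auto simp: defs)
  have B: "refl_on (Field (\<beta> i)) (\<beta> i)" "trans (\<beta> i)" "antisym (\<beta> i)"
      "total_on (Field (\<beta> i)) (\<beta> i)" "wf (\<beta> i - Id)" if "i \<in> Field r" for i
    using \<beta>[OF that] by (auto simp: defs)
  have F: "Field ?S = (SIGMA i : Field r. Field (\<beta> i))"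
    using assms by (rule Field_ord_sum)
  have S: "((i, x), (j, y)) \<in> ?S \<longleftrightarrow>
      (i, j) \<in> r \<and> i \<noteq> j \<and> x \<in> Field (\<beta> i) \<and> y \<in> Field (\<beta> j) \<or>
      i = j \<and> i \<in> Field r \<and> (x, y) \<in> \<beta> i" for i x j y
    by (auto simp: ord_sum_def)
  have "refl_on (Field ?S) ?S"
  proof (rule refl_onI)
    fix p assume p: "p \<in> Field ?S"
    obtain i x where [simp]: "p = (i, x)" by (cases p)
    show "(p, p) \<in> ?S" using p refl_onD[OF B(1), of i x] by (simp add: F S)
  qed
  moreover have "trans ?S"
  proof (rule transI)
    fix p q s assume *: "(p, q) \<in> ?S" "(q, s) \<in> ?S"
    obtain i x j y k z where [simp]: "p = (i, x)" "q = (j, y)" "s = (k, z)"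
      by (cases p; cases q; cases s)
    show "(p, s) \<in> ?S"
    proof (cases "i = j \<and> j = k")
      case True
      then show ?thesis using * transD[OF B(2), of i x y z] by (simp add: S)
    next
      case False
      then show ?thesis using * transD[OF R(2), of i j k] antisymD[OF R(3), of i j]
        by (auto simp: S intro: FieldI1 FieldI2)
    qed
  qed
  moreover have "antisym ?S"
  proof (rule antisymI)
    fix p q assume "(p, q) \<in> ?S" "(q, p) \<in> ?S"
    moreover obtain i x j y where "p = (i, x)" "q = (j, y)" by (cases p; cases q)
    ultimately show "p = q"
      using antisymD[OF R(3), of i j] antisymD[OF B(3), of i x y] by (simp add: S) blast
  qed
  moreover have "total_on (Field ?S) ?S"
    unfolding F total_on_def
  proof (intro ballI impI)
    fix p q assume *: "p \<in> (SIGMA i : Field r. Field (\<beta> i))"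
      "q \<in> (SIGMA i : Field r. Field (\<beta> i))" "p \<noteq> q"
    obtain i x j y where [simp]: "p = (i, x)" "q = (j, y)" by (cases p; cases q)
    show "(p, q) \<in> ?S \<or> (q, p) \<in> ?S"
    proof (cases "i = j")
      case True
      then show ?thesis using * B(4)[of i] by (auto simp: total_on_def S)
    next
      case False
      then show ?thesis using * R(4) by (auto simp: total_on_def S)
    qed
  qed
  moreover have "wf (?S - Id)"
  proof (rule wfI_min)
    fix p :: "'a \<times> 'b" and Q assume "p \<in> Q"
    then have "fst p \<in> fst ` Q" by simp
    then obtain i where i: "i \<in> fst ` Q" "\<And>j. (j, i) \<in> r - Id \<Longrightarrow> j \<notin> fst ` Q"
      using wfE_min[OF R(5)] by metis
    obtain x where x: "(i, x) \<in> Q"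
        "\<And>y. i \<in> Field r \<Longrightarrow> (y, x) \<in> \<beta> i - Id \<Longrightarrow> (i, y) \<notin> Q"
    proof (cases "i \<in> Field r")
      case True
      from i(1) obtain x0 where "x0 \<in> {x. (i, x) \<in> Q}" by auto
      then obtain x where "x \<in> {x. (i, x) \<in> Q}"
          "\<And>y. (y, x) \<in> \<beta> i - Id \<Longrightarrow> y \<notin> {x. (i, x) \<in> Q}"
        by (rule wfE_min[OF B(5)[OF True]]) (rule that)
      then show ?thesis using that[of x] by simp
    next
      case False
      with i(1) that show ?thesis by auto
    qed
    have "q \<notin> Q" if "(q, (i, x)) \<in> ?S - Id" for q
    proof
      assume "q \<in> Q"
      obtain j y where [simp]: "q = (j, y)" by (cases q)
      have "j \<in> fst ` Q" using \<open>q \<in> Q\<close> by force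
      then have "(j, i) \<notin> r - Id" using i(2) by blast
      with that have "j = i" "i \<in> Field r" "(y, x) \<in> \<beta> i - Id" by (auto simp: S)
      with x(2) \<open>q \<in> Q\<close> show False by simp
    qed
    with x(1) show "\<exists>z\<in>Q. \<forall>y. (y, z) \<in> ?S - Id \<longrightarrow> y \<notin> Q" by blast
  qed
  moreover have "?S \<subseteq> Field ?S \<times> Field ?S"
    by (auto intro: FieldI1 FieldI2)
  ultimately show ?thesis by (simp add: defs)
qed

end

theory Submission
  imports Defs "HOL-Library.Countable_Set_Type"
begin

text \<open>
  Consider first sums of length \<open>\<omega>\<close> with terms in a countable set \<open>B\<close>. Call an ordinal recurrent
  for a sequence if it is at most infinitely many of the terms. By well-foundedness all but finitely
  many terms are recurrent. If two sequences have the same finite head, only recurrent terms after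
  it, and the same recurrent elements of \<open>B\<close>, then each sum embeds into the other, so they are
  equal. The recurrent elements form an initial segment of \<open>B\<close>, and a countable well-order has only
  countably many of those. Hence there are countably many sums.

  A countable well-order of indices splits into \<open>\<omega>\<close> consecutive blocks, each of which is strictly
  shorter than the whole or has at most one element. By induction on the length each block
  contributes countably many order types, which reduces the general case to length \<open>\<omega>\<close>.
\<close>

section \<open>Strictly increasing maps and comparison of sums\<close>

text \<open>Otherwise \<open>s\<close> would be isomorphic to the part of \<open>r\<close> below
  some \<open>a\<close>, and \<open>f\<close> followed by that isomorphism would be a strictly
  increasing self-map of \<open>r\<close> moving \<open>a\<close> downwards. Comparisons thus need
  no initial-segment embeddings.\<close>

lemma ordLeq_if_strict_mono:
  assumes r: "Well_order r" and s: "Well_order s"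
    and f: "f ` Field r \<subseteq> Field s"
    and mono: "\<And>x y. (x, y) \<in> r - Id \<Longrightarrow> (f x, f y) \<in> s - Id"
  shows "r \<le>o s"
proof (rule ccontr)
  assume "\<not> r \<le>o s"
  then have "s <o r" using not_ordLeq_iff_ordLess[OF s r] by simp
  then obtain a where a: "a \<in> Field r" and iso: "s =o Restr r (underS r a)"
    using ordLess_iff_ordIso_Restr[OF r s] by blast
  obtain g where "iso s (Restr r (underS r a)) g"
    using iso by (auto simp: ordIso_def)
  then have bij: "bij_betw g (Field s) (Field (Restr r (underS r a)))"
    and g: "\<And>x y. x \<in> Field s \<Longrightarrow> y \<in> Field s \<Longrightarrow>
      (x, y) \<in> s \<longleftrightarrow> (g x, g y) \<in> Restr r (underS r a)"
    unfolding iso_iff2 by auto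
  let ?h = "g \<circ> f"
  have h_less: "(?h x, a) \<in> r - Id" if "x \<in> Field r" for x
    using bij_betwE[OF bij] f that Field_Restr_subset[of r "underS r a"]
    unfolding underS_def by fastforce
  have h_mono: "(?h x, ?h y) \<in> r - Id" if "(x, y) \<in> r - Id" for x y
  proof -
    have "f x \<in> Field s" "f y \<in> Field s" "(f x, f y) \<in> s - Id"
      using f that mono[OF that] by (auto simp: Field_def)
    then show ?thesis
      using g[of "f x" "f y"] bij_betw_imp_inj_on[OF bij] by (auto dest: inj_onD)
  qed
  have "wf (r - Id)" using r by (simp add: well_order_on_def)
  then have "(?h x, x) \<notin> r - Id" for x
  proof (induction x rule: wf_induct_rule)
    case (less x)
    then show ?case using h_mono[of "?h x" x] by blast
  qed
  with h_less[OF a] show False by blast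
qed

lemma strict_mono_if_ordLeq:
  assumes "r \<le>o s"
  obtains f where "f ` Field r \<subseteq> Field s" and "\<And>x y. (x, y) \<in> r - Id \<Longrightarrow> (f x, f y) \<in> s - Id"
proof -
  have r: "Well_order r" using assms by (simp add: ordLeq_def)
  obtain f where f: "embed r s f" using assms by (auto simp: ordLeq_def)
  have "(f x, f y) \<in> s - Id" if "(x, y) \<in> r - Id" for x y
    using that embed_inj_on[OF r f] embed_compat[OF f]
    by (auto simp: compat_def inj_on_def intro: FieldI1 FieldI2)
  with embed_Field[OF f] show ?thesis by (rule that)
qed

text \<open>The index map and the maps between corresponding terms combine into one map of pairs.
  Strictness of \<open>g\<close> keeps distinct terms apart, and \<open>g\<close> may skip indices,
  which the sums of length \<omega> need.\<close>

lemma ord_sum_mono: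
  assumes r: "Well_order r" and s: "Well_order s"
    and \<gamma>: "\<And>j. j \<in> Field s \<Longrightarrow> Well_order (\<gamma> j)"
    and g: "g ` Field r \<subseteq> Field s"
    and g_mono: "\<And>i j. (i, j) \<in> r - Id \<Longrightarrow> (g i, g j) \<in> s - Id"
    and le: "\<And>i. i \<in> Field r \<Longrightarrow> \<beta> i \<le>o \<gamma> (g i)"
  shows "ord_sum r \<beta> \<le>o ord_sum s \<gamma>"
proof -
  have \<beta>: "Well_order (\<beta> i)" if "i \<in> Field r" for i
    using le[OF that] by (simp add: ordLeq_def)
  have "\<exists>f. f ` Field (\<beta> i) \<subseteq> Field (\<gamma> (g i)) \<and>
      (\<forall>x y. (x, y) \<in> \<beta> i - Id \<longrightarrow> (f x, f y) \<in> \<gamma> (g i) - Id)" if "i \<in> Field r" for i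
    using strict_mono_if_ordLeq[OF le[OF that]] by metis
  then obtain f where f: "\<And>i. i \<in> Field r \<Longrightarrow> f i ` Field (\<beta> i) \<subseteq> Field (\<gamma> (g i))"
    and f_mono: "\<And>i x y. i \<in> Field r \<Longrightarrow> (x, y) \<in> \<beta> i - Id \<Longrightarrow> (f i x, f i y) \<in> \<gamma> (g i) - Id"
    by metis
  show ?thesis
  proof (rule ordLeq_if_strict_mono)
    let ?f = "\<lambda>(i, x). (g i, f i x)"
    show "Well_order (ord_sum r \<beta>)" "Well_order (ord_sum s \<gamma>)"
      using r s \<beta> \<gamma> by (auto intro: Well_order_ord_sum)
    show "?f ` Field (ord_sum r \<beta>) \<subseteq> Field (ord_sum s \<gamma>)"
      using f g by (auto simp: Field_ord_sum r s \<beta> \<gamma>)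
    show "(?f p, ?f q) \<in> ord_sum s \<gamma> - Id" if pq: "(p, q) \<in> ord_sum r \<beta> - Id" for p q
    proof -
      obtain i x j y where [simp]: "p = (i, x)" "q = (j, y)" by (cases p; cases q)
      consider "(i, j) \<in> r - Id" "x \<in> Field (\<beta> i)" "y \<in> Field (\<beta> j)"
        | "i = j" "i \<in> Field r" "(x, y) \<in> \<beta> i - Id"
        using pq by (auto simp: ord_sum_def)
      then show ?thesis
      proof cases
        case 1
        then have "i \<in> Field r" "j \<in> Field r" by (auto intro: FieldI1 FieldI2)
        with 1 g_mono[OF 1(1)] f[of i] f[of j] show ?thesis by (auto simp: ord_sum_def)
      next
        case 2
        with f_mono[OF 2(2,3)] g show ?thesis by (auto simp: ord_sum_def)
      qed
    qed
  qed
qed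

lemma ord_sum_cong:
  assumes "\<And>i. i \<in> Field r \<Longrightarrow> \<beta> i = \<gamma> i"
  shows "ord_sum r \<beta> = ord_sum r \<gamma>"
proof -
  have "\<beta> i = \<gamma> i" "\<beta> j = \<gamma> j" if "(i, j) \<in> r" for i j
    using assms[of i] assms[of j] that by (blast intro: FieldI1 FieldI2)+
  with assms show ?thesis unfolding ord_sum_def by auto
qed

lemma ord_sum_ordIso_cong:
  assumes r: "Well_order r" and iso: "\<And>i. i \<in> Field r \<Longrightarrow> \<beta> i =o \<gamma> i"
  shows "ord_sum r \<beta> =o ord_sum r \<gamma>"
proof -
  have le: "\<beta> i \<le>o \<gamma> i" "\<gamma> i \<le>o \<beta> i" if "i \<in> Field r" for i
    using iso[OF that] by (simp_all add: ordIso_iff_ordLeq)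
  then have "Well_order (\<beta> i)" "Well_order (\<gamma> i)" if "i \<in> Field r" for i
    using that by (auto simp: ordLeq_def)
  with le r show ?thesis
    unfolding ordIso_iff_ordLeq
    by (intro conjI; intro ord_sum_mono[where g = id]) auto
qed

lemma order_type_eq_iff:
  fixes s t :: "'c rel"
  assumes "Well_order s"
  shows "order_type s = order_type t \<longleftrightarrow> s =o t"
proof
  assume "order_type s = order_type t"
  moreover have "s \<in> order_type s" using ordIso_reflexive[OF assms] by (simp add: order_type_def)
  ultimately have "t =o s" by (simp add: order_type_def)
  then show "s =o t" by (rule ordIso_symmetric)
next
  assume st: "s =o t"
  have "s =o u \<longleftrightarrow> t =o u" for u :: "'c rel"
    using ordIso_transitive[OF st] ordIso_transitive[OF ordIso_symmetric[OF st]] by blast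
  then show "order_type s = order_type t" by (simp add: order_type_def)
qed

section \<open>Sums of length \<omega> with terms in a countable set\<close>

definition recurrent :: "(nat \<Rightarrow> 'c rel) \<Rightarrow> 'c rel \<Rightarrow> bool"
  where "recurrent \<gamma> b \<longleftrightarrow> (\<forall>M. \<exists>m\<ge>M. b \<le>o \<gamma> m)"

text \<open>Take a least non-recurrent term. From some index on, every term is strictly smaller than
  it, hence recurrent by minimality.\<close>

lemma eventually_recurrent:
  assumes wo: "\<And>n. Well_order (\<gamma> n)"
  shows "\<exists>N. \<forall>n\<ge>N. recurrent \<gamma> (\<gamma> n)"
proof (rule ccontr)
  assume *: "\<not> ?thesis"
  then obtain n0 where "\<not> recurrent \<gamma> (\<gamma> n0)" by blast
  then have "\<gamma> n0 \<in> \<gamma> ` {n. \<not> recurrent \<gamma> (\<gamma> n)}" by blast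
  then obtain n where n: "\<not> recurrent \<gamma> (\<gamma> n)"
    and least: "\<And>m. \<gamma> m <o \<gamma> n \<Longrightarrow> recurrent \<gamma> (\<gamma> m)"
    by (rule wfE_min[OF wf_ordLess]) blast
  from n obtain M where M: "\<And>m. m \<ge> M \<Longrightarrow> \<not> \<gamma> n \<le>o \<gamma> m"
    by (auto simp: recurrent_def)
  from * obtain m where "m \<ge> M" "\<not> recurrent \<gamma> (\<gamma> m)" by blast
  with M least not_ordLeq_iff_ordLess[OF wo wo] show False by blast
qed

text \<open>The terms of \<open>\<gamma>\<close> are placed one after another: head terms at their
  own index, each later term at a dominating term of \<open>\<gamma>'\<close> further to the right,
  which recurrence provides.\<close>

lemma ord_sum_natLeq_mono:
  assumes \<gamma>': "\<And>n. Well_order (\<gamma>' n)"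
    and head: "\<And>n. n < N \<Longrightarrow> \<gamma> n \<le>o \<gamma>' n"
    and tail: "\<And>n. n \<ge> N \<Longrightarrow> recurrent \<gamma>' (\<gamma> n)"
  shows "ord_sum natLeq \<gamma> \<le>o ord_sum natLeq \<gamma>'"
proof -
  \<comment> \<open>The condition \<open>g n = n\<close> on the head is carried along because it
    ensures that the next head index exceeds the last one used.\<close>
  have "\<exists>g. \<forall>n. (\<gamma> n \<le>o \<gamma>' (g n) \<and> (n < N \<longrightarrow> g n = n)) \<and> g n < g (Suc n)"
  proof (rule dependent_nat_choice)
    show "\<exists>x. \<gamma> 0 \<le>o \<gamma>' x \<and> (0 < N \<longrightarrow> x = 0)"
      using head[of 0] tail[of 0] by (cases "0 < N") (auto simp: recurrent_def)
    show "\<exists>y. (\<gamma> (Suc n) \<le>o \<gamma>' y \<and> (Suc n < N \<longrightarrow> y = Suc n)) \<and> x < y"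
      if "\<gamma> n \<le>o \<gamma>' x \<and> (n < N \<longrightarrow> x = n)" for x n
    proof (cases "Suc n < N")
      case True
      with that head[of "Suc n"] show ?thesis by auto
    next
      case False
      with tail[of "Suc n"] obtain y where "y \<ge> Suc x" "\<gamma> (Suc n) \<le>o \<gamma>' y"
        by (auto simp: recurrent_def)
      with False show ?thesis by auto
    qed
  qed
  then obtain g where g: "\<And>n. \<gamma> n \<le>o \<gamma>' (g n)" "\<And>n. g n < g (Suc n)" by blast
  have "strict_mono g" using g(2) by (simp add: strict_mono_Suc_iff)
  then have "(g i, g j) \<in> natLeq - Id" if "(i, j) \<in> natLeq - Id" for i j
    using that strict_monoD[of g i j] by (auto simp: natLeq_def)
  then show ?thesis
    using g(1) \<gamma>' by (intro ord_sum_mono[OF natLeq_Well_order natLeq_Well_order, where g = g])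
      (auto simp: Field_natLeq)
qed

text \<open>One preimage per value of \<open>k\<close> recovers all values of \<open>F\<close>. In
  the applications \<open>k\<close> is an invariant that determines \<open>F\<close> and takes
  countably many values.\<close>

lemma countable_image_if_factors:
  assumes "countable (k ` X)" and "\<And>x y. x \<in> X \<Longrightarrow> y \<in> X \<Longrightarrow> k x = k y \<Longrightarrow> F x = F y"
  shows "countable (F ` X)"
proof -
  have "F ` X \<subseteq> (F \<circ> inv_into X k) ` k ` X"
  proof
    fix z assume "z \<in> F ` X"
    then obtain x where x: "x \<in> X" "z = F x" by blast
    then have "F x = F (inv_into X k (k x))"
      by (intro assms(2)) (auto intro: inv_into_into simp: f_inv_into_f)
    with x show "z \<in> (F \<circ> inv_into X k) ` k ` X" by auto
  qed
  with assms(1) show ?thesis by (meson countable_image countable_subset)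
qed

text \<open>A set of this kind other than \<open>B\<close> is determined by a least missing element
  \<open>c\<close>: it consists of the elements of \<open>B\<close> strictly below
  \<open>c\<close>.\<close>

lemma countable_downward_closed:
  assumes B: "countable B" and wo: "\<And>b. b \<in> B \<Longrightarrow> Well_order b"
  shows "countable {D. D \<subseteq> B \<and> (\<forall>b\<in>D. \<forall>c\<in>B. c \<le>o b \<longrightarrow> c \<in> D)}"
proof (rule countable_subset)
  show "countable (insert B ((\<lambda>c. {b \<in> B. b <o c}) ` B))" using B by simp
  show "{D. D \<subseteq> B \<and> (\<forall>b\<in>D. \<forall>c\<in>B. c \<le>o b \<longrightarrow> c \<in> D)} \<subseteq> insert B ((\<lambda>c. {b \<in> B. b <o c}) ` B)"
  proof
    fix D assume D: "D \<in> {D. D \<subseteq> B \<and> (\<forall>b\<in>D. \<forall>c\<in>B. c \<le>o b \<longrightarrow> c \<in> D)}"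
    show "D \<in> insert B ((\<lambda>c. {b \<in> B. b <o c}) ` B)"
    proof (cases "D = B")
      case False
      with D obtain c0 where "c0 \<in> B - D" by blast
      then obtain c where c: "c \<in> B - D" and least: "\<And>b. b <o c \<Longrightarrow> b \<notin> B - D"
        by (rule wfE_min[OF wf_ordLess]) (rule that)
      have "b \<in> D \<longleftrightarrow> b <o c" if b: "b \<in> B" for b
      proof
        assume "b <o c"
        with least b show "b \<in> D" by blast
      next
        assume "b \<in> D"
        with c D have "\<not> c \<le>o b" by blast
        with b c wo show "b <o c" by (simp add: not_ordLeq_iff_ordLess)
      qed
      with D have "D = {b \<in> B. b <o c}" by auto
      with c show ?thesis by blast
    qed simp
  qed
qed

lemma countable_omega_sums:
  assumes B: "countable B" and wo: "\<And>b. b \<in> B \<Longrightarrow> Well_order b"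
  shows "countable ((\<lambda>\<gamma>. order_type (ord_sum natLeq \<gamma>)) ` (UNIV \<rightarrow> B))"
proof -
  define N where "N \<gamma> = (SOME N. \<forall>n\<ge>N. recurrent \<gamma> (\<gamma> n))" for \<gamma> :: "nat \<Rightarrow> 'a rel"
  define D where "D \<gamma> = {b \<in> B. recurrent \<gamma> b}" for \<gamma>
  \<comment> \<open>The key that classifies a sequence: the head is a finite list over
    \<open>B\<close>, and \<open>D \<gamma>\<close> is downward closed in \<open>B\<close>, so both
    components range over countable sets.\<close>
  define k where "k \<gamma> = (map \<gamma> [0..<N \<gamma>], D \<gamma>)" for \<gamma>
  have N: "recurrent \<gamma> (\<gamma> n)" if "\<gamma> \<in> UNIV \<rightarrow> B" "n \<ge> N \<gamma>" for \<gamma> n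
    using someI_ex[OF eventually_recurrent[of \<gamma>]] that wo unfolding N_def by blast
  show ?thesis
  proof (rule countable_image_if_factors)
    have "D \<gamma> \<in> {D. D \<subseteq> B \<and> (\<forall>b\<in>D. \<forall>c\<in>B. c \<le>o b \<longrightarrow> c \<in> D)}" for \<gamma>
      using ordLeq_transitive by (fastforce simp: D_def recurrent_def)
    then have "k ` (UNIV \<rightarrow> B) \<subseteq>
        lists B \<times> {D. D \<subseteq> B \<and> (\<forall>b\<in>D. \<forall>c\<in>B. c \<le>o b \<longrightarrow> c \<in> D)}"
      by (auto simp: k_def Pi_iff)
    moreover have "countable (lists B \<times> {D. D \<subseteq> B \<and> (\<forall>b\<in>D. \<forall>c\<in>B. c \<le>o b \<longrightarrow> c \<in> D)})"
      using B wo by (intro countable_SIGMA countable_lists countable_downward_closed) auto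
    ultimately show "countable (k ` (UNIV \<rightarrow> B))" by (rule countable_subset)
  next
    have le: "ord_sum natLeq \<gamma> \<le>o ord_sum natLeq \<gamma>'"
      if \<gamma>: "\<gamma> \<in> UNIV \<rightarrow> B" "\<gamma>' \<in> UNIV \<rightarrow> B" and k: "k \<gamma> = k \<gamma>'" for \<gamma> \<gamma>'
    proof (rule ord_sum_natLeq_mono[where N = "N \<gamma>"])
      show "Well_order (\<gamma>' n)" for n using \<gamma>(2) wo by auto
      have *: "map \<gamma> [0..<N \<gamma>] = map \<gamma>' [0..<N \<gamma>']" "D \<gamma> = D \<gamma>'"
        using k by (auto simp: k_def)
      \<comment> \<open>Equal lists have equal lengths, so both heads end at the same index.\<close>
      from *(1) have "N \<gamma> = N \<gamma>'" by (metis diff_zero length_map length_upt)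
      with *(1) have "\<gamma> n = \<gamma>' n" if "n < N \<gamma>" for n
        using that by (simp add: map_eq_conv)
      then show "\<gamma> n \<le>o \<gamma>' n" if "n < N \<gamma>" for n
        using that \<gamma>(2) by (auto intro!: ordLeq_reflexive wo)
      show "recurrent \<gamma>' (\<gamma> n)" if "n \<ge> N \<gamma>" for n
        using N[OF \<gamma>(1) that] \<gamma>(1) *(2) by (auto simp: D_def)
    qed
    show "order_type (ord_sum natLeq \<gamma>) = order_type (ord_sum natLeq \<gamma>')"
      if \<gamma>: "\<gamma> \<in> UNIV \<rightarrow> B" "\<gamma>' \<in> UNIV \<rightarrow> B" and k: "k \<gamma> = k \<gamma>'" for \<gamma> \<gamma>'
    proof -
      have "ord_sum natLeq \<gamma> =o ord_sum natLeq \<gamma>'"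
        using le[OF \<gamma> k] le[OF \<gamma>(2,1) k[symmetric]] by (simp add: ordIso_iff_ordLeq)
      moreover from this have "Well_order (ord_sum natLeq \<gamma>)" by (simp add: ordIso_def)
      ultimately show ?thesis by (simp add: order_type_eq_iff)
    qed
  qed
qed

section \<open>Cutting a countable well-order into consecutive blocks\<close>

lemma Field_Restr_Int:
  assumes "Well_order r"
  shows "Field (Restr r K) = Field r \<inter> K"
  using assms by (intro Refl_Field_Restr) (simp add: order_on_defs)

text \<open>General associativity of the sum. Monotonicity of \<open>g\<close> makes its fibres
  consecutive intervals, so tagging a pair with its block number and forgetting the tag are both
  strictly increasing. Empty fibres add nothing.\<close>

lemma ord_sum_blocks:
  fixes g :: "'a \<Rightarrow> nat"
  assumes r: "Well_order r" and \<beta>: "\<And>i. i \<in> Field r \<Longrightarrow> Well_order (\<beta> i)"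
    and g: "\<And>i j. (i, j) \<in> r \<Longrightarrow> g i \<le> g j"
  shows "ord_sum r \<beta> =o ord_sum natLeq (\<lambda>n. ord_sum (Restr r {i. g i = n}) \<beta>)"
    (is "?S =o ord_sum natLeq ?\<gamma>")
proof -
  let ?T = "ord_sum natLeq ?\<gamma>"
  have restr: "Well_order (Restr r K)" for K using r by (rule Well_order_Restr)
  have \<gamma>: "Well_order (?\<gamma> n)" for n
    using \<beta> by (intro Well_order_ord_sum[OF restr]) (simp add: Field_Restr_Int[OF r])
  have F\<gamma>: "Field (?\<gamma> n) = (SIGMA i : Field r \<inter> {i. g i = n}. Field (\<beta> i))" for n
    using \<beta> by (subst Field_ord_sum[OF restr]) (simp_all add: Field_Restr_Int[OF r])
  have FS: "Field ?S = (SIGMA i : Field r. Field (\<beta> i))"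
    using r \<beta> by (rule Field_ord_sum)
  have FT: "Field ?T = (SIGMA n : UNIV. Field (?\<gamma> n))"
    using \<gamma> by (subst Field_ord_sum[OF natLeq_Well_order]) (simp_all add: Field_natLeq)
  have "(n, m) \<in> natLeq \<longleftrightarrow> n \<le> m" for n m by (simp add: natLeq_def)
  then have memT: "((n, p), (m, q)) \<in> ?T \<longleftrightarrow>
      n < m \<and> p \<in> Field (?\<gamma> n) \<and> q \<in> Field (?\<gamma> m) \<or> n = m \<and> (p, q) \<in> ?\<gamma> n" for n m p q
    by (auto simp: ord_sum_def[of natLeq] Field_natLeq)
  have S: "Well_order ?S" using r \<beta> by (rule Well_order_ord_sum)
  have T: "Well_order ?T" using natLeq_Well_order \<gamma> by (rule Well_order_ord_sum)
  have tot: "(i, j) \<in> r \<or> (j, i) \<in> r" if "i \<in> Field r" "j \<in> Field r" "i \<noteq> j" for i j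
    using r that by (auto simp: order_on_defs total_on_def)
  have "?S \<le>o ?T"
  proof (rule ordLeq_if_strict_mono[OF S T])
    let ?f = "\<lambda>(i, x). (g i, (i, x))"
    show "?f ` Field ?S \<subseteq> Field ?T" by (auto simp: FS FT F\<gamma>)
    fix p q assume pq: "(p, q) \<in> ?S - Id"
    obtain i x j y where [simp]: "p = (i, x)" "q = (j, y)" by (cases p; cases q)
    from pq have "p \<in> Field ?S" "q \<in> Field ?S" by (auto simp: Field_def)
    then have F: "i \<in> Field r" "x \<in> Field (\<beta> i)" "j \<in> Field r" "y \<in> Field (\<beta> j)"
      by (auto simp: FS)
    have "(i, j) \<in> r \<or> i = j" using pq by (auto simp: ord_sum_def)
    then have "g i \<le> g j" using g by auto
    moreover have "((i, x), (j, y)) \<in> ?\<gamma> (g i)" if "g i = g j"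
      using that pq F by (auto simp: ord_sum_def Field_Restr_Int[OF r])
    ultimately show "(?f p, ?f q) \<in> ?T - Id"
      using F pq by (cases "g i = g j") (auto simp: memT F\<gamma>)
  qed
  moreover have "?T \<le>o ?S"
  proof (rule ordLeq_if_strict_mono[OF T S])
    show "snd ` Field ?T \<subseteq> Field ?S" by (auto simp: FS FT F\<gamma>)
    fix p q assume pq: "(p, q) \<in> ?T - Id"
    obtain n i x m j y where [simp]: "p = (n, i, x)" "q = (m, j, y)"
      by (cases p; cases q) auto
    from pq have "p \<in> Field ?T" "q \<in> Field ?T" by (auto simp: Field_def)
    then have F: "i \<in> Field r" "x \<in> Field (\<beta> i)" "j \<in> Field r" "y \<in> Field (\<beta> j)"
        "n = g i" "m = g j"
      by (auto simp: FT F\<gamma>)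
    show "(snd p, snd q) \<in> ?S - Id"
    proof (cases "n = m")
      case True
      with pq have "((i, x), (j, y)) \<in> ?\<gamma> n - Id" by (auto simp: memT)
      then show ?thesis using F by (auto simp: ord_sum_def)
    next
      case False
      with pq have "n < m" by (auto simp: memT)
      with F g[of j i] have "(j, i) \<notin> r" "i \<noteq> j" by auto
      with tot F have "(i, j) \<in> r" by blast
      with F \<open>i \<noteq> j\<close> show ?thesis by (auto simp: ord_sum_def)
    qed
  qed
  ultimately show ?thesis by (simp add: ordIso_iff_ordLeq)
qed

text \<open>Odd blocks have at most one element, and even blocks lie strictly below some element.
  Whether \<open>r\<close> has a maximum therefore makes no difference.\<close>
lemma nat_block_map:
  assumes r: "Well_order r" and count: "countable (Field r)"
  obtains g :: "'a \<Rightarrow> nat" where "\<And>i j. (i, j) \<in> r \<Longrightarrow> g i \<le> g j"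
    and "\<And>n. Field r \<inter> {i. g i = n} = {} \<or>
      (\<exists>m\<in>Field r. Field r \<inter> {i. g i = n} \<subseteq> underS r m \<or> Field r \<inter> {i. g i = n} \<subseteq> {m})"
proof -
  let ?e = "from_nat_into (Field r)"
  \<comment> \<open>Index of the first enumerated element that bounds \<open>i\<close>; for
    \<open>i\<close> in the field one exists, as \<open>i\<close> itself is enumerated.\<close>
  define f where "f i = (LEAST n. (i, ?e n) \<in> r)" for i
  \<comment> \<open>Elements with the same first bound share a block, except that the bound itself
    gets a block of its own right after them.\<close>
  define g where "g i = (if i = ?e (f i) then 2 * f i + 1 else 2 * f i)" for i
  have R: "refl_on (Field r) r" "trans r" "antisym r"
    using r by (auto simp: order_on_defs)
  have e: "\<exists>n. (i, ?e n) \<in> r" if "i \<in> Field r" for i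
    using from_nat_into_surj[OF count that] refl_onD[OF R(1) that] by metis
  have f: "(i, ?e (f i)) \<in> r" if "i \<in> Field r" for i
    unfolding f_def using e[OF that] by (rule LeastI_ex)
  have mono: "g i \<le> g j" if ij: "(i, j) \<in> r" for i j
  proof -
    have j: "(j, ?e (f j)) \<in> r" using ij by (intro f) (rule FieldI2)
    with ij R(2) have "(i, ?e (f j)) \<in> r" by (meson transD)
    then have "f i \<le> f j" unfolding f_def[of i] by (rule Least_le)
    \<comment> \<open>If \<open>i\<close> is its own first bound and \<open>f i = f j\<close>, then
      \<open>i\<close> also bounds \<open>j\<close>, so they coincide.\<close>
    moreover have "f i < f j \<or> j = i \<or> i \<noteq> ?e (f i)"
      using \<open>f i \<le> f j\<close> ij j antisymD[OF R(3), of i j] by (metis le_neq_implies_less)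
    ultimately show ?thesis by (auto simp: g_def)
  qed
  have block: "\<exists>m\<in>Field r. Field r \<inter> {i. g i = n} \<subseteq> underS r m \<or> Field r \<inter> {i. g i = n} \<subseteq> {m}"
    if "Field r \<inter> {i. g i = n} \<noteq> {}" for n
  proof (intro bexI)
    show "?e (n div 2) \<in> Field r" using that by (intro from_nat_into) blast
    have "f i = n div 2 \<and> (even n \<longleftrightarrow> i \<noteq> ?e (f i))" if "g i = n" for i
      using that by (auto simp: g_def split: if_splits)
    then show "Field r \<inter> {i. g i = n} \<subseteq> underS r (?e (n div 2)) \<or>
        Field r \<inter> {i. g i = n} \<subseteq> {?e (n div 2)}"
      using f by (cases "even n") (fastforce simp: underS_def)+
  qed
  show ?thesis
  proof (rule that)
    show "g i \<le> g j" if "(i, j) \<in> r" for i j using that by (rule mono)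
  qed (use block in blast)
qed

section \<open>Induction on the length of the sum\<close>

text \<open>The terms are given by all functions into a countable set \<open>A\<close> rather than
  by reindexings of one sequence, because this form is inherited by the blocks.\<close>

lemma countable_ord_sums:
  assumes "Well_order r" and "countable (Field r)"
    and A: "countable A" "\<And>a. a \<in> A \<Longrightarrow> Well_order a"
  shows "countable ((\<lambda>\<beta>. order_type (ord_sum r \<beta>)) ` (Field r \<rightarrow> A))"
  using wf_ordLess assms(1,2)
proof (induction r rule: wf_induct_rule)
  case (less r)
  note r = \<open>Well_order r\<close>
  obtain g :: "'a \<Rightarrow> nat" where g: "\<And>i j. (i, j) \<in> r \<Longrightarrow> g i \<le> g j"
    and blocks: "\<And>n. Field r \<inter> {i. g i = n} = {} \<or>
      (\<exists>m\<in>Field r. Field r \<inter> {i. g i = n} \<subseteq> underS r m \<or> Field r \<inter> {i. g i = n} \<subseteq> {m})"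
    using nat_block_map[OF less.prems] by blast
  let ?r = "\<lambda>n. Restr r {i. g i = n}"
  let ?T = "\<lambda>n. (\<lambda>\<beta>. order_type (ord_sum (?r n) \<beta>)) ` (Field r \<rightarrow> A)"
  have restr: "Well_order (Restr r K)" for K using r by (rule Well_order_Restr)
  have F: "Field (?r n) = Field r \<inter> {i. g i = n}" for n by (rule Field_Restr_Int[OF r])
  have cT: "countable (?T n)" for n
    using blocks[of n]
  proof (elim disjE bexE)
    assume "Field r \<inter> {i. g i = n} = {}"
    then have "?r n = {}" by (auto dest: FieldI1)
    then have "ord_sum (?r n) \<beta> = {}" for \<beta> :: "'a \<Rightarrow> 'b rel" by (auto simp: ord_sum_def)
    then have "?T n \<subseteq> {order_type {}}" by auto
    then show ?thesis by (rule countable_subset) simp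
  next
    fix m assume m: "m \<in> Field r" and sub: "Field r \<inter> {i. g i = n} \<subseteq> underS r m"
    \<comment> \<open>The block lies in a proper initial segment and is therefore shorter than
      \<open>r\<close>, so the induction hypothesis applies.\<close>
    have "?r n \<le>o Restr r (underS r m)"
      using sub restr by (intro ordLeq_if_strict_mono[where f = id])
        (auto simp: F Field_Restr_Int[OF r] intro: FieldI1 FieldI2)
    then have "?r n <o r"
      using underS_Restr_ordLess[OF r] m by (metis ordLeq_ordLess_trans equals0D)
    moreover have "countable (Field (?r n))"
      using less.prems(2) by (auto simp: F intro: countable_subset)
    ultimately have "countable ((\<lambda>\<beta>. order_type (ord_sum (?r n) \<beta>)) ` (Field (?r n) \<rightarrow> A))"
      using restr by (intro less.IH) auto
    moreover have "?T n \<subseteq> (\<lambda>\<beta>. order_type (ord_sum (?r n) \<beta>)) ` (Field (?r n) \<rightarrow> A)"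
      by (intro image_mono) (auto simp: F)
    ultimately show ?thesis by (rule countable_subset[rotated])
  next
    fix m assume m: "m \<in> Field r" and sub: "Field r \<inter> {i. g i = n} \<subseteq> {m}"
    \<comment> \<open>Such a block may be all of \<open>r\<close>, which rules out the induction
      hypothesis; but its sum depends only on the single value \<open>\<beta> m\<close> in
      \<open>A\<close>.\<close>
    have const: "ord_sum (?r n) \<beta> = ord_sum (?r n) (\<lambda>_. \<beta> m)" for \<beta> :: "'a \<Rightarrow> 'b rel"
    proof (rule ord_sum_cong)
      fix i assume "i \<in> Field (?r n)"
      with sub F[of n] have "i = m" by blast
      then show "\<beta> i = \<beta> m" by simp
    qed
    have "?T n = (\<lambda>\<beta>. order_type (ord_sum (?r n) (\<lambda>_. \<beta> m))) ` (Field r \<rightarrow> A)"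
      by (rule image_cong[OF refl]) (rule arg_cong[OF const])
    also have "\<dots> \<subseteq> (\<lambda>a. order_type (ord_sum (?r n) (\<lambda>_. a))) ` A"
      using m by auto
    finally have "?T n \<subseteq> (\<lambda>a. order_type (ord_sum (?r n) (\<lambda>_. a))) ` A" .
    with A(1) show ?thesis by (meson countable_image countable_subset)
  qed
  let ?B0 = "\<Union>n. (\<lambda>\<beta>. ord_sum (?r n) \<beta>) ` (Field r \<rightarrow> A)"
  have wo: "Well_order s" if "s \<in> ?B0" for s
    using that A(2) restr by (auto simp: F Pi_iff intro!: Well_order_ord_sum)
  \<comment> \<open>There may be uncountably many block sums as relations, whereas the result for
    length \<omega> asks for a countable set of terms. Hence one representative per order type is
    chosen.\<close>
  define rep where "rep s = (SOME t. t \<in> order_type s)" for s :: "('a \<times> 'b) rel"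
  have rep: "s =o rep s" if "s \<in> ?B0" for s
    using someI[of "\<lambda>t. t \<in> order_type s" s] ordIso_reflexive[OF wo[OF that]]
    unfolding rep_def order_type_def by auto
  define B where "B = rep ` ?B0"
  \<comment> \<open>\<open>rep s\<close> depends on \<open>s\<close> only through its order type, so
    countability of the sets \<open>?T n\<close> passes to \<open>B\<close>.\<close>
  have "B = (\<lambda>T. SOME t. t \<in> T) ` (\<Union>n. ?T n)"
    by (simp add: B_def rep_def image_UN image_image)
  with cT have B: "countable B" by simp
  have woB: "Well_order b" if b: "b \<in> B" for b
  proof -
    from b obtain s where "s \<in> ?B0" "b = rep s" unfolding B_def by (rule imageE)
    with rep[of s] show ?thesis unfolding ordIso_def by auto
  qed
  let ?\<gamma> = "\<lambda>\<beta> n. rep (ord_sum (?r n) \<beta>)"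
  have iso: "ord_sum r \<beta> =o ord_sum natLeq (?\<gamma> \<beta>)" if \<beta>: "\<beta> \<in> Field r \<rightarrow> A" for \<beta>
  proof (rule ordIso_transitive)
    show "ord_sum r \<beta> =o ord_sum natLeq (\<lambda>n. ord_sum (?r n) \<beta>)"
      using \<beta> A(2) g by (intro ord_sum_blocks[OF r]) auto
    show "ord_sum natLeq (\<lambda>n. ord_sum (?r n) \<beta>) =o ord_sum natLeq (?\<gamma> \<beta>)"
      using \<beta> by (intro ord_sum_ordIso_cong natLeq_Well_order rep) auto
  qed
  show ?case
  \<comment> \<open>The order types of \<open>ord_sum r \<beta>\<close> and of the isomorphic
    \<omega>-sum are sets of relations on different types and cannot be equated; the latter serves
    as the key for the former.\<close>
  proof (rule countable_image_if_factors)
    have "(\<lambda>\<beta>. order_type (ord_sum natLeq (?\<gamma> \<beta>))) ` (Field r \<rightarrow> A) \<subseteq>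
        (\<lambda>\<gamma>. order_type (ord_sum natLeq \<gamma>)) ` (UNIV \<rightarrow> B)"
      unfolding B_def by blast
    with countable_omega_sums[OF B woB]
    show "countable ((\<lambda>\<beta>. order_type (ord_sum natLeq (?\<gamma> \<beta>))) ` (Field r \<rightarrow> A))"
      by (meson countable_subset)
  next
    fix \<beta> \<beta>' assume \<beta>: "\<beta> \<in> Field r \<rightarrow> A" "\<beta>' \<in> Field r \<rightarrow> A"
      and eq: "order_type (ord_sum natLeq (?\<gamma> \<beta>)) = order_type (ord_sum natLeq (?\<gamma> \<beta>'))"
    have wos: "Well_order (ord_sum r \<beta>)" "Well_order (ord_sum natLeq (?\<gamma> \<beta>))"
      using iso[OF \<beta>(1)] by (auto simp: ordIso_def)
    from eq have "ord_sum natLeq (?\<gamma> \<beta>) =o ord_sum natLeq (?\<gamma> \<beta>')"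
      by (simp add: order_type_eq_iff wos)
    then have "ord_sum r \<beta> =o ord_sum r \<beta>'"
      by (rule ordIso_transitive[OF ordIso_transitive[OF iso[OF \<beta>(1)]] ordIso_symmetric[OF iso[OF \<beta>(2)]]])
    then show "order_type (ord_sum r \<beta>) = order_type (ord_sum r \<beta>')"
      by (simp add: order_type_eq_iff wos)
  qed
qed

section \<open>Sums over all maps of the index set\<close>

theorem corollary2p4:
  fixes r :: "'a rel" and \<alpha> :: "'a \<Rightarrow> 'b rel"
  assumes "Well_order r"
    and "natLeq \<le>o r" and "r <o cardSuc natLeq"
    and "\<And>i. i \<in> Field r \<Longrightarrow> Well_order (\<alpha> i)"
  shows "countable (sum_order_types r \<alpha>)"
proof -
  \<comment> \<open>A well-order is at least as long as the cardinal of its field, and a cardinal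
    below \<open>cardSuc natLeq\<close> is at most \<open>natLeq\<close>.\<close>
  have "|Field r| <o cardSuc natLeq"
    using card_of_least[OF assms(1)] assms(3) by (rule ordLeq_ordLess_trans)
  then have r: "countable (Field r)"
    unfolding countable_card_le_natLeq
    by (rule iffD1[OF cardSuc_ordLeq_ordLess[OF natLeq_Card_order card_of_Card_order]])
  \<comment> \<open>All terms \<open>\<alpha> (\<phi> i)\<close> lie in the image of the field under
    \<open>\<alpha>\<close>, which is countable along with the field.\<close>
  have "countable ((\<lambda>\<beta>. order_type (ord_sum r \<beta>)) ` (Field r \<rightarrow> \<alpha> ` Field r))"
    using assms(1,4) r by (intro countable_ord_sums) auto
  moreover have "sum_order_types r \<alpha> \<subseteq> (\<lambda>\<beta>. order_type (ord_sum r \<beta>)) ` (Field r \<rightarrow> \<alpha> ` Field r)"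
    unfolding sum_order_types_def by blast
  ultimately show ?thesis by (rule countable_subset[rotated])
qed

end
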